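(* For all integers $0\leq r\leq n$, \[k(r,n)=r!\,(n-r)!+\sum_{i=1}^{r}\sum_{j=1}^{n-r}\binom{n-i-j}{r-i}\cdot (r)_{i-1}\cdot(n-r)_{j-1}.\]
   Context: Let $\mathfrak{S}_n$ be the group of permutations of $\{1,\dots,n\}$, written in one-line notation $w=w(1)\cdots w(n)$. A permutation $w\in\mathfrak{S}_n$ contains the split pattern $3|12$ with respect to position $r$ if there are indices $i_1\leq r<i_2<i_3$ with $w(i_2)<w(i_3)<w(i_1)$; it contains the split pattern $23|1$ with respect to position $r$ if there are indices $i_1<i_2\leq r<i_3$ with $w(i_3)<w(i_1)<w(i_2)$. Otherwise it avoids the pattern with respect to position $r$. Let $K(r,n)$ be the set of $w\in\mathfrak{S}_n$ avoiding both $3|12$ and $23|1$ with respect to position $r$, and $k(r,n)=|K(r,n)|$, with the convention $k(0,0)=1$. For an integer $m$ and $i\geq 1$, $(m)_i=m(m-1)\cdots(m-i+1)$ is the falling factorial, and $(m)_0=1$. Empty sums are $0$. *)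

theory Defs
  imports "HOL-Combinatorics.Permutations"
begin

definition contains_3_12 :: "nat \<Rightarrow> nat \<Rightarrow> (nat \<Rightarrow> nat) \<Rightarrow> bool" where
  "contains_3_12 r n w \<longleftrightarrow>
     (\<exists>i1\<in>{1..n}. \<exists>i2\<in>{1..n}. \<exists>i3\<in>{1..n}.
        i1 \<le> r \<and> r < i2 \<and> i2 < i3 \<and> w i2 < w i3 \<and> w i3 < w i1)"

definition contains_23_1 :: "nat \<Rightarrow> nat \<Rightarrow> (nat \<Rightarrow> nat) \<Rightarrow> bool" where
  "contains_23_1 r n w \<longleftrightarrow>
     (\<exists>i1\<in>{1..n}. \<exists>i2\<in>{1..n}. \<exists>i3\<in>{1..n}.
        i1 < i2 \<and> i2 \<le> r \<and> r < i3 \<and> w i3 < w i1 \<and> w i1 < w i2)"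

definition K :: "nat \<Rightarrow> nat \<Rightarrow> (nat \<Rightarrow> nat) set" where
  "K r n = {w. w permutes {1..n} \<and> \<not> contains_3_12 r n w \<and> \<not> contains_23_1 r n w}"

definition k :: "nat \<Rightarrow> nat \<Rightarrow> nat" where
  "k r n = card (K r n)"

definition falling_factorial :: "int \<Rightarrow> nat \<Rightarrow> int" where
  "falling_factorial m i = (\<Prod>t<i. m - int t)"

text \<open>The convention \<open>k(0,0) = 1\<close> needs no special case: the identity is the
  only permutation of the empty set.\<close>

lemma k_0_0: "k 0 0 = 1"
proof -
  have "K 0 0 = {id}"
    by (auto simp: K_def contains_3_12_def contains_23_1_def)
  then show ?thesis by (simp add: k_def)
qed

end

theory Submission
  imports Defs "HOL-Combinatorics.Multiset_Permutations"
begin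

text \<open>
  Let \<open>A\<close> be the set of values of \<open>w\<close> at the positions \<open>1, \<dots>, r\<close> and \<open>B\<close> its complement.
  Avoidance means that the elements of \<open>A\<close> above \<open>min B\<close> appear in decreasing order, and so do
  the elements of \<open>B\<close> below \<open>max A\<close>. For \<open>A = {1..r}\<close> this is no condition. Otherwise put
  \<open>i = min B\<close> and \<open>j = n + 1 - max A\<close>: then \<open>i - 1\<close> elements of \<open>A\<close> and \<open>j - 1\<close> elements of \<open>B\<close>
  are unconstrained, which leaves \<open>(r)_(i-1)\<close> orders of \<open>A\<close> and \<open>(n-r)_(j-1)\<close> orders of \<open>B\<close>,
  and \<open>A\<close> is determined by choosing its \<open>r - i\<close> elements strictly between \<open>i\<close> and \<open>n + 1 - j\<close>.
\<close>

section \<open>Orders of a finite set that are decreasing on a subset\<close>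

lemma permutes_map_list:
  assumes "xs \<in> permutations_of_set S" and "ys \<in> permutations_of_set S"
  obtains p where "p permutes S" and "map p xs = ys"
proof -
  have xs: "set xs = S" "distinct xs" and ys: "set ys = S" "distinct ys"
    using assms by (auto dest: permutations_of_setD)
  have len: "length xs = length ys"
    using xs ys by (metis distinct_card)
  let ?I = "{..<length xs}"
  have bx: "bij_betw ((!) xs) ?I S" and "bij_betw ((!) ys) ?I S"
    using xs ys len by (auto intro!: bij_betw_nth)
  \<comment> \<open>Matches the two lists position by position; \<open>restrict_id\<close> then
    extends this map by the identity outside \<open>S\<close>.\<close>
  let ?g = "(!) ys \<circ> inv_into ?I ((!) xs)"
  have "bij_betw ?g S S"
    using bij_betw_trans[OF bij_betw_inv_into[OF bx] \<open>bij_betw ((!) ys) ?I S\<close>] .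
  then have "restrict_id ?g S permutes S"
    by (rule permutes_restrict_id)
  moreover have "map (restrict_id ?g S) xs = ys"
  proof (rule nth_equalityI)
    fix i assume "i < length (map (restrict_id ?g S) xs)"
    then have i: "i \<in> ?I" by simp
    then have "inv_into ?I ((!) xs) (xs ! i) = i"
      using bx by (simp add: bij_betw_def)
    then show "map (restrict_id ?g S) xs ! i = ys ! i"
      using i xs by (auto simp: restrict_id_def)
  qed (simp add: len)
  ultimately show thesis by (rule that)
qed

lemma filter_permutations_of_set:
  assumes "S \<subseteq> A" and "xs \<in> permutations_of_set A"
  shows "filter (\<lambda>x. x \<in> S) xs \<in> permutations_of_set S"
  using assms by (auto simp: permutations_of_set_def)

text \<open>Relabelling the elements of \<open>S\<close> shows that all orders of \<open>S\<close> occur equally often as the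
  restriction of an order of \<open>A\<close>.\<close>

lemma card_permutations_of_set_filter_eq:
  assumes "finite A" and "S \<subseteq> A" and zs: "zs \<in> permutations_of_set S"
  shows "card {xs \<in> permutations_of_set A. filter (\<lambda>x. x \<in> S) xs = zs} * fact (card S) = fact (card A)"
proof -
  define F where "F zs = {xs \<in> permutations_of_set A. filter (\<lambda>x. x \<in> S) xs = zs}" for zs
  have finF: "finite (F ys)" for ys by (simp add: F_def)
  \<comment> \<open>Proved for arbitrary \<open>us\<close> and \<open>vs\<close>, so exchanging them
    shows that all fibres have the same size.\<close>
  have le: "card (F us) \<le> card (F vs)"
    if us: "us \<in> permutations_of_set S" and vs: "vs \<in> permutations_of_set S" for us vs
  proof -
    obtain p where p: "p permutes S" "map p us = vs"
      using permutes_map_list[OF us vs] .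
    have pA: "p permutes A"
      using p(1) \<open>S \<subseteq> A\<close> by (rule permutes_subset)
    have "inj_on (map p) (F us)"
      using permutes_inj[OF pA] by (auto intro: inj_onI)
    \<comment> \<open>\<open>p\<close> preserves both \<open>S\<close> and its complement, so
      filtering to \<open>S\<close> commutes with \<open>map p\<close>.\<close>
    moreover have "map p ` F us \<subseteq> F vs"
      using p permutes_in_image[OF p(1)] permutes_image[OF pA] permutes_inj_on[OF pA]
      by (auto simp: F_def permutations_of_set_def filter_map o_def distinct_map)
    ultimately show ?thesis using finF by (rule card_inj_on_le)
  qed
  \<comment> \<open>Count the orders of \<open>A\<close> by grouping them according to their
    restriction to \<open>S\<close>.\<close>
  have "fact (card A) = (\<Sum>xs\<in>permutations_of_set A. 1::nat)"
    using \<open>finite A\<close> by simp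
  also have "\<dots> = (\<Sum>ys\<in>permutations_of_set S. \<Sum>xs\<in>F ys. 1)"
    unfolding F_def using filter_permutations_of_set[OF \<open>S \<subseteq> A\<close>]
    by (intro sum.group[symmetric]) auto
  also have "\<dots> = (\<Sum>ys\<in>permutations_of_set S. card (F zs))"
    using le zs by (intro sum.cong) (auto intro!: antisym)
  also have "\<dots> = card (F zs) * fact (card S)"
    using assms by (simp add: finite_subset[OF \<open>S \<subseteq> A\<close>])
  finally show ?thesis by (simp add: F_def)
qed

lemma sorted_wrt_filter_iff:
  "sorted_wrt R (filter P xs) \<longleftrightarrow> sorted_wrt (\<lambda>x y. P x \<and> P y \<longrightarrow> R x y) xs"
  by (induction xs) auto

text \<open>Exactly one order of \<open>S\<close> is decreasing, so the lists counted form a single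
  fibre of the restriction map. Entries are distinct, hence the weak inequality suffices.\<close>

lemma card_permutations_of_set_decreasing_on:
  fixes A S :: "'a::linorder set"
  assumes "finite A" and "S \<subseteq> A"
  shows "card {xs \<in> permutations_of_set A. sorted_wrt (\<lambda>x y. x \<in> S \<and> y \<in> S \<longrightarrow> y \<le> x) xs} *
    fact (card S) = fact (card A)"
proof -
  have finS: "finite S" using assms by (rule finite_subset[rotated])
  let ?zs = "rev (sorted_list_of_set S)"
  have "sorted_wrt (\<lambda>x y. x \<in> S \<and> y \<in> S \<longrightarrow> y \<le> x) xs \<longleftrightarrow> filter (\<lambda>x. x \<in> S) xs = ?zs"
    if "xs \<in> permutations_of_set A" for xs
  proof -
    have *: "set (filter (\<lambda>x. x \<in> S) xs) = S" "distinct (filter (\<lambda>x. x \<in> S) xs)"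
      using filter_permutations_of_set[OF assms(2) that] by (auto simp del: set_filter dest: permutations_of_setD)
    have "sorted_wrt (\<lambda>x y. x \<in> S \<and> y \<in> S \<longrightarrow> y \<le> x) xs \<longleftrightarrow> sorted (rev (filter (\<lambda>x. x \<in> S) xs))"
      by (simp add: sorted_wrt_rev sorted_wrt_filter_iff)
    also have "\<dots> \<longleftrightarrow> rev (filter (\<lambda>x. x \<in> S) xs) = sorted_list_of_set S"
      using * finS by (metis distinct_rev set_rev sorted_list_of_set.idem_if_sorted_distinct
          sorted_list_of_set.sorted_sorted_key_list_of_set)
    finally show ?thesis by (simp only: rev_swap)
  qed
  then have "{xs \<in> permutations_of_set A. sorted_wrt (\<lambda>x y. x \<in> S \<and> y \<in> S \<longrightarrow> y \<le> x) xs} =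
    {xs \<in> permutations_of_set A. filter (\<lambda>x. x \<in> S) xs = ?zs}" by blast
  moreover have "?zs \<in> permutations_of_set S"
    using finS by (auto simp: permutations_of_set_def)
  ultimately show ?thesis
    using card_permutations_of_set_filter_eq[OF assms] by simp
qed

text \<open>Turns the quotient \<open>m! / (m - i)!\<close> into a falling factorial without any
  division.\<close>

lemma falling_factorial_mult_fact:
  "i \<le> m \<Longrightarrow> falling_factorial (int m) i * fact (m - i) = fact m"
proof (induction i)
  case 0
  then show ?case by (simp add: falling_factorial_def)
next
  case (Suc i)
  \<comment> \<open>The new last factor \<open>m - i\<close> is split off from
    \<open>fact (m - i)\<close>.\<close>
  then have "m - i = Suc (m - Suc i)" by simp
  then have "(fact (m - i) :: int) = (int m - int i) * fact (m - Suc i)"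
    using Suc.prems by (simp add: of_nat_diff)
  then show ?case using Suc by (simp add: falling_factorial_def mult.assoc)
qed

text \<open>Here \<open>i\<close> is the number of unconstrained elements of \<open>A\<close>.
  Multiplied by the nonzero \<open>fact (card S)\<close>, both sides become
  \<open>fact (card A)\<close>.\<close>

lemma card_permutations_of_set_decreasing_on_falling_factorial:
  fixes A S :: "'a::linorder set"
  assumes "finite A" and "S \<subseteq> A" and "card S + i = card A"
  shows "int (card {xs \<in> permutations_of_set A. sorted_wrt (\<lambda>x y. x \<in> S \<and> y \<in> S \<longrightarrow> y \<le> x) xs}) =
    falling_factorial (int (card A)) i" (is "int ?c = _")
proof -
  have "int ?c * fact (card S) = fact (card A)"
    using arg_cong[OF card_permutations_of_set_decreasing_on[OF assms(1,2)], of int] by simp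
  also have "\<dots> = falling_factorial (int (card A)) i * fact (card S)"
  proof -
    have "i \<le> card A" "card A - i = card S" using assms(3) by auto
    then show ?thesis using falling_factorial_mult_fact[of i "card A"] by simp
  qed
  finally show ?thesis by simp
qed

section \<open>Splitting a permutation at position \<open>r\<close> into two words\<close>

text \<open>In \<open>23|1\<close> a single letter lies right of the bar, so the right half matters
  only through its set \<open>B\<close> of values; in \<open>3|12\<close> the roles are exchanged.
  Once \<open>A\<close> and \<open>B\<close> are fixed, the two halves can be chosen
  independently.\<close>

definition left_words :: "nat set \<Rightarrow> nat set \<Rightarrow> nat list set" where
  "left_words A B =
    {xs \<in> permutations_of_set A. sorted_wrt (\<lambda>x y. \<forall>b\<in>B. \<not> (b < x \<and> x < y)) xs}"

definition right_words :: "nat set \<Rightarrow> nat set \<Rightarrow> nat list set" where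
  "right_words A B =
    {ys \<in> permutations_of_set B. sorted_wrt (\<lambda>x y. \<forall>a\<in>A. \<not> (x < y \<and> y < a)) ys}"

text \<open>A permutation is the identity outside \<open>{1..n}\<close>, so its word determines it.
  Surjectivity follows by counting, since both sets have \<open>n!\<close> elements.\<close>

lemma bij_betw_one_line_notation:
  "bij_betw (\<lambda>w. map w [1..<Suc n]) {w. w permutes {1..n}} (permutations_of_set {1..n})"
proof -
  let ?f = "\<lambda>w::nat \<Rightarrow> nat. map w [1..<Suc n]"
  have set: "set [1..<Suc n] = {1..n}" by auto
  have inj: "inj_on ?f {w. w permutes {1..n}}"
  proof (rule inj_onI, rule ext)
    fix v w x assume "v \<in> {w. w permutes {1..n}}" "w \<in> {w. w permutes {1..n}}" "?f v = ?f w"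
    then show "v x = w x"
      using set by (cases "x \<in> {1..n}") (auto simp: permutes_def simp del: upt_Suc)
  qed
  have "?f ` {w. w permutes {1..n}} \<subseteq> permutations_of_set {1..n}"
  proof (rule image_subsetI)
    fix w assume "w \<in> {w. w permutes {1..n}}"
    then have w: "w permutes {1..n}" by simp
    have "set (?f w) = {1..n}" by (simp only: set_map set permutes_image[OF w])
    moreover have "distinct (?f w)"
      using permutes_inj_on[OF w] by (simp add: distinct_map del: upt_Suc)
    ultimately show "?f w \<in> permutations_of_set {1..n}" by (rule permutations_of_setI)
  qed
  then have "?f ` {w. w permutes {1..n}} = permutations_of_set {1..n}"
    using inj by (intro card_subset_eq) (auto simp: card_image card_permutations)
  with inj show ?thesis by (simp add: bij_betw_def)
qed

lemma sorted_wrt_map_upt: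
  "sorted_wrt R (map w [a..<b]) \<longleftrightarrow> (\<forall>i j. a \<le> i \<longrightarrow> i < j \<longrightarrow> j < b \<longrightarrow> R (w i) (w j))"
proof -
  have "(\<forall>i j. i < j \<longrightarrow> j < b - a \<longrightarrow> R (w (a + i)) (w (a + j))) \<longleftrightarrow>
    (\<forall>i j. a \<le> i \<longrightarrow> i < j \<longrightarrow> j < b \<longrightarrow> R (w i) (w j))"
  proof (intro iffI allI impI)
    fix i j assume *: "\<forall>i j. i < j \<longrightarrow> j < b - a \<longrightarrow> R (w (a + i)) (w (a + j))" "a \<le> i" "i < j" "j < b"
    show "R (w i) (w j)" using *(1)[rule_format, of "i - a" "j - a"] *(2-) by simp
  qed auto
  then show ?thesis by (simp add: sorted_wrt_iff_nth_less)
qed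

text \<open>Each pattern has two letters on one side of the bar and one on the other. The pair
  becomes a \<open>sorted_wrt\<close> condition on one word, and the position of the single letter
  is traded for its value.\<close>

lemma K_iff_left_right_words:
  assumes "r \<le> n" and w: "w permutes {1..n}"
  shows "w \<in> K r n \<longleftrightarrow>
    map w [1..<Suc r] \<in> left_words (w ` {1..r}) ({1..n} - w ` {1..r}) \<and>
    map w [Suc r..<Suc n] \<in> right_words (w ` {1..r}) ({1..n} - w ` {1..r})"
proof -
  have sets: "set [1..<Suc r] = {1..r}" "set [Suc r..<Suc n] = {Suc r..n}" by auto
  have inj: "inj w" using w by (rule permutes_inj)
  have B: "{1..n} - w ` {1..r} = w ` {Suc r..n}"
  proof -
    have "{1..n} - w ` {1..r} = w ` {1..n} - w ` {1..r}"
      using permutes_image[OF w] by simp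
    also have "\<dots> = w ` ({1..n} - {1..r})" by (rule image_set_diff[OF inj, symmetric])
    also have "{1..n} - {1..r} = {Suc r..n}" by auto
    finally show ?thesis .
  qed
  have "map w [1..<Suc r] \<in> permutations_of_set (w ` {1..r})"
    "map w [Suc r..<Suc n] \<in> permutations_of_set (w ` {Suc r..n})"
    using sets inj by (auto simp: permutations_of_set_def distinct_map inj_on_def simp del: upt_Suc dest: injD)
  moreover have "\<not> contains_23_1 r n w \<longleftrightarrow>
    sorted_wrt (\<lambda>x y. \<forall>b\<in>w ` {Suc r..n}. \<not> (b < x \<and> x < y)) (map w [1..<Suc r])"
    (is "_ \<longleftrightarrow> ?sorted")
  proof -
    have "?sorted \<longleftrightarrow> (\<forall>i1 i2. 1 \<le> i1 \<longrightarrow> i1 < i2 \<longrightarrow> i2 < Suc r \<longrightarrow>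
      (\<forall>i3\<in>{Suc r..n}. \<not> (w i3 < w i1 \<and> w i1 < w i2)))"
      unfolding sorted_wrt_map_upt by simp
    also have "\<dots> \<longleftrightarrow> \<not> contains_23_1 r n w"
    proof
      assume "\<not> contains_23_1 r n w"
      then have "\<not> (w i3 < w i1 \<and> w i1 < w i2)"
        if "i1 \<in> {1..n}" "i2 \<in> {1..n}" "i3 \<in> {1..n}" "i1 < i2" "i2 \<le> r" "r < i3" for i1 i2 i3
        using that unfolding contains_23_1_def by blast
      then show "\<forall>i1 i2. 1 \<le> i1 \<longrightarrow> i1 < i2 \<longrightarrow> i2 < Suc r \<longrightarrow>
          (\<forall>i3\<in>{Suc r..n}. \<not> (w i3 < w i1 \<and> w i1 < w i2))"
        using \<open>r \<le> n\<close> by (meson Suc_le_eq atLeastAtMost_iff le_trans less_Suc_eq_le less_imp_le)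
    qed (unfold contains_23_1_def, meson Suc_le_eq atLeastAtMost_iff less_Suc_eq_le)
    finally show ?thesis by simp
  qed
  moreover have "\<not> contains_3_12 r n w \<longleftrightarrow>
    sorted_wrt (\<lambda>x y. \<forall>a\<in>w ` {1..r}. \<not> (x < y \<and> y < a)) (map w [Suc r..<Suc n])"
    (is "_ \<longleftrightarrow> ?sorted")
  proof -
    have "?sorted \<longleftrightarrow> (\<forall>i2 i3. Suc r \<le> i2 \<longrightarrow> i2 < i3 \<longrightarrow> i3 < Suc n \<longrightarrow>
      (\<forall>i1\<in>{1..r}. \<not> (w i2 < w i3 \<and> w i3 < w i1)))"
      unfolding sorted_wrt_map_upt by simp
    also have "\<dots> \<longleftrightarrow> \<not> contains_3_12 r n w"
    proof
      assume "\<not> contains_3_12 r n w"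
      then have avoids: "\<not> (w i2 < w i3 \<and> w i3 < w i1)"
        if "i1 \<in> {1..n}" "i2 \<in> {1..n}" "i3 \<in> {1..n}" "i1 \<le> r" "r < i2" "i2 < i3" for i1 i2 i3
        using that unfolding contains_3_12_def by blast
      show "\<forall>i2 i3. Suc r \<le> i2 \<longrightarrow> i2 < i3 \<longrightarrow> i3 < Suc n \<longrightarrow>
          (\<forall>i1\<in>{1..r}. \<not> (w i2 < w i3 \<and> w i3 < w i1))"
      proof (intro allI impI ballI)
        fix i2 i3 i1 assume "Suc r \<le> i2" "i2 < i3" "i3 < Suc n" "i1 \<in> {1..r}"
        then show "\<not> (w i2 < w i3 \<and> w i3 < w i1)"
          using \<open>r \<le> n\<close> by (intro avoids) auto
      qed
    qed (unfold contains_3_12_def, meson Suc_le_eq atLeastAtMost_iff less_Suc_eq_le)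
    finally show ?thesis by simp
  qed
  ultimately show ?thesis
    using w unfolding B K_def left_words_def right_words_def by blast
qed

text \<open>Permutations are grouped by the set \<open>A\<close> of their first \<open>r\<close>
  values. Cutting the word after position \<open>r\<close> maps each group bijectively onto a
  product.\<close>

lemma k_eq_sum_left_right_words:
  assumes "r \<le> n"
  shows "k r n = (\<Sum>A | A \<subseteq> {1..n} \<and> card A = r.
    card (left_words A ({1..n} - A)) * card (right_words A ({1..n} - A)))"
proof -
  let ?S = "{A. A \<subseteq> {1..n} \<and> card A = r}"
  have finK: "finite (K r n)"
    by (rule finite_subset[OF _ finite_permutations[of "{1..n}"]]) (auto simp: K_def)
  have img: "(\<lambda>w. w ` {1..r}) ` K r n \<subseteq> ?S"
  proof (rule image_subsetI)
    fix w assume "w \<in> K r n"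
    then have w: "w permutes {1..n}" by (simp add: K_def)
    have "w ` {1..r} \<subseteq> w ` {1..n}" using assms by (intro image_mono) auto
    then show "w ` {1..r} \<in> ?S"
      using w by (simp add: permutes_image card_image permutes_inj_on)
  qed
  have fibre: "card {w \<in> K r n. w ` {1..r} = A} =
      card (left_words A ({1..n} - A)) * card (right_words A ({1..n} - A))"
    if A: "A \<in> ?S" for A
  proof -
    let ?B = "{1..n} - A"
    let ?f = "\<lambda>w::nat \<Rightarrow> nat. (map w [1..<Suc r], map w [Suc r..<Suc n])"
    have split: "map w [1..<Suc n] = map w [1..<Suc r] @ map w [Suc r..<Suc n]" for w :: "nat \<Rightarrow> nat"
      using assms upt_add_eq_append[of 1 "Suc r" "n - r"] by (simp flip: map_append del: upt_Suc)
    have inj: "inj_on ?f {w \<in> K r n. w ` {1..r} = A}"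
    proof (rule inj_onI)
      fix v w assume vw: "v \<in> {w \<in> K r n. w ` {1..r} = A}" "w \<in> {w \<in> K r n. w ` {1..r} = A}" "?f v = ?f w"
      then have "map v [1..<Suc n] = map w [1..<Suc n]"
        unfolding split by simp
      with vw show "v = w"
        using bij_betw_imp_inj_on[OF bij_betw_one_line_notation[of n]]
        by (auto simp: K_def inj_on_def simp del: upt_Suc)
    qed
    have "?f ` {w \<in> K r n. w ` {1..r} = A} = left_words A ?B \<times> right_words A ?B" (is "?L = ?R")
    proof (intro equalityI subsetI)
      fix p assume "p \<in> ?L"
      then show "p \<in> ?R"
        using K_iff_left_right_words[OF assms] by (auto simp: K_def simp del: upt_Suc)
    next
      fix p assume "p \<in> ?R"
      then obtain xs ys where p: "p = (xs, ys)" "xs \<in> left_words A ?B" "ys \<in> right_words A ?B"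
        by blast
      then have xs: "set xs = A" "distinct xs" and ys: "set ys = ?B" "distinct ys"
        by (auto simp: left_words_def right_words_def permutations_of_set_def)
      have "xs @ ys \<in> permutations_of_set {1..n}"
        using xs ys A by (auto simp: permutations_of_set_def)
      then obtain w where w: "w permutes {1..n}" "map w [1..<Suc n] = xs @ ys"
        using bij_betw_imp_surj_on[OF bij_betw_one_line_notation[of n]]
        by (metis (mono_tags, lifting) imageE mem_Collect_eq)
      \<comment> \<open>As \<open>card A = r\<close>, cutting the glued word after position
        \<open>r\<close> gives back exactly \<open>xs\<close> and \<open>ys\<close>.\<close>
      have "length xs = r" using xs A by (simp flip: distinct_card)
      then have eq: "map w [1..<Suc r] = xs" "map w [Suc r..<Suc n] = ys"
        using w(2) unfolding split by (simp_all del: upt_Suc)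
      have "w ` {1..r} = set (map w [1..<Suc r])"
        by (simp add: atLeastLessThanSuc_atLeastAtMost del: upt_Suc)
      then have "w ` {1..r} = A" unfolding eq xs .
      moreover have "w \<in> K r n"
        using K_iff_left_right_words[OF assms w(1)] p eq \<open>w ` {1..r} = A\<close> by (simp del: upt_Suc)
      ultimately show "p \<in> ?L" using p eq by (auto intro!: image_eqI[of _ _ w] simp del: upt_Suc)
    qed
    then show ?thesis using card_image[OF inj] by (simp add: card_cartesian_product)
  qed
  have "k r n = (\<Sum>w\<in>K r n. 1)" by (simp add: k_def)
  also have "\<dots> = (\<Sum>A\<in>?S. \<Sum>w | w \<in> K r n \<and> w ` {1..r} = A. 1)"
    using finK img by (intro sum.group[symmetric]) auto
  also have "\<dots> = (\<Sum>A\<in>?S. card (left_words A ({1..n} - A)) * card (right_words A ({1..n} - A)))"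
    using fibre by (intro sum.cong) auto
  finally show ?thesis .
qed

section \<open>Classifying the sets of left values by \<open>i\<close> and \<open>j\<close>\<close>

text \<open>The sets \<open>A\<close> whose complement in \<open>{1..n}\<close> has minimum \<open>i\<close>, and whose maximum is
  \<open>n + 1 - j\<close>.\<close>

definition value_sets :: "nat \<Rightarrow> nat \<Rightarrow> nat \<Rightarrow> nat \<Rightarrow> nat set set" where
  "value_sets r n i j = {A. A \<subseteq> {1..n} \<and> card A = r \<and> {1..<i} \<subseteq> A \<and> i \<notin> A \<and>
    n + 1 - j \<in> A \<and> A \<inter> {n + 1 - j<..n} = {}}"

lemma card_value_sets:
  assumes "r \<le> n" "i \<in> {1..r}" "j \<in> {1..n - r}"
  shows "card (value_sets r n i j) = (n - i - j) choose (r - i)"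
proof -
  let ?M = "n + 1 - j"
  let ?X = "{X. X \<subseteq> {i<..<?M} \<and> card X = r - i}"
  let ?h = "\<lambda>X. {1..<i} \<union> X \<union> {?M}"
  have iM: "i < ?M" using assms by auto
  \<comment> \<open>The forced elements are the \<open>i - 1\<close> values below \<open>i\<close>
    together with \<open>?M\<close>, so \<open>i\<close> in all.\<close>
  have card_h: "card (?h X) = card X + i" if "X \<subseteq> {i<..<?M}" for X
  proof -
    have "finite X" using that by (rule finite_subset) simp
    moreover have "{1..<i} \<inter> X = {}" "?M \<notin> {1..<i} \<union> X" using that iM by auto
    ultimately show ?thesis using assms(2) by (simp add: card_Un_disjoint)
  qed
  have "inj_on ?h ?X"
  proof (rule inj_onI)
    fix X Y assume "X \<in> ?X" "Y \<in> ?X" "?h X = ?h Y"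
    \<comment> \<open>Intersecting with the open interval removes the forced elements and recovers
      the chosen ones.\<close>
    moreover have "Z = ?h Z \<inter> {i<..<?M}" if "Z \<in> ?X" for Z using that by auto
    ultimately show "X = Y" by metis
  qed
  moreover have "?h ` ?X = value_sets r n i j"
  proof (intro equalityI subsetI)
    fix A assume "A \<in> ?h ` ?X"
    then obtain X where X: "X \<in> ?X" "A = ?h X" by blast
    then have "card A = r" using card_h[of X] assms(2) by simp
    moreover have "{i<..<?M} \<subseteq> {1..n}" using assms by auto
    then have "A \<subseteq> {1..n}" using X iM assms by auto
    moreover have "{1..<i} \<subseteq> A" "i \<notin> A" "?M \<in> A" "A \<inter> {?M<..n} = {}"
      using X iM assms by auto
    ultimately show "A \<in> value_sets r n i j" by (simp add: value_sets_def)
  next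
    fix A assume "A \<in> value_sets r n i j"
    then have A: "A \<subseteq> {1..n}" "card A = r" "{1..<i} \<subseteq> A" "i \<notin> A" "?M \<in> A" "A \<inter> {?M<..n} = {}"
      by (auto simp: value_sets_def)
    have "x \<in> ?h (A \<inter> {i<..<?M})" if "x \<in> A" for x
    proof -
      have "x \<le> ?M" "1 \<le> x" "x \<noteq> i"
        using that A by (meson atLeastAtMost_iff disjoint_iff greaterThanAtMost_iff not_le subsetD)+
      then show ?thesis using that by auto
    qed
    then have eq: "A = ?h (A \<inter> {i<..<?M})" using A by blast
    have "card (A \<inter> {i<..<?M}) = r - i"
      using card_h[of "A \<inter> {i<..<?M}"] A(2) eq by simp
    then show "A \<in> ?h ` ?X" using eq by (intro image_eqI[of _ _ "A \<inter> {i<..<?M}"]) auto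
  qed
  ultimately have "card (value_sets r n i j) = card ?X" using card_image[of ?h ?X] by simp
  also have "\<dots> = card {i<..<?M} choose (r - i)" by (rule n_subsets) simp
  also have "card {i<..<?M} = n - i - j" by simp
  finally show ?thesis .
qed

text \<open>As \<open>i\<close> is the least element of the complement, some \<open>b\<close> lies
  below \<open>x\<close> iff \<open>i < x\<close>. A forbidden pair is thus an ascent
  \<open>x < y\<close> with both entries above \<open>i\<close>, and the \<open>i - 1\<close> values
  below \<open>i\<close> are free.\<close>

lemma card_left_words_value_sets:
  assumes "r \<le> n" "i \<in> {1..r}" "j \<in> {1..n - r}" and "A \<in> value_sets r n i j"
  shows "int (card (left_words A ({1..n} - A))) = falling_factorial (int r) (i - 1)"
proof -
  let ?S = "A - {1..<i}"
  from assms have A: "A \<subseteq> {1..n}" "card A = r" "{1..<i} \<subseteq> A" "i \<notin> A"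
    by (auto simp: value_sets_def)
  have finA: "finite A" using A(1) by (rule finite_subset) simp
  have i: "i \<in> {1..n} - A" using A assms by auto
  have S: "x \<in> ?S \<longleftrightarrow> i < x" if "x \<in> A" for x
    using that A by (cases x i rule: linorder_cases) auto
  have "left_words A ({1..n} - A) =
    {xs \<in> permutations_of_set A. sorted_wrt (\<lambda>x y. x \<in> ?S \<and> y \<in> ?S \<longrightarrow> y \<le> x) xs}"
  proof -
    have "(\<forall>b\<in>{1..n} - A. \<not> (b < x \<and> x < y)) \<longleftrightarrow> (x \<in> ?S \<and> y \<in> ?S \<longrightarrow> y \<le> x)"
      if "x \<in> A" "y \<in> A" for x y
    proof -
      have "b \<in> {1..n} - A \<Longrightarrow> i \<le> b" for b using A(3) by (meson DiffE atLeastAtMost_iff atLeastLessThan_iff not_le subsetD)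
      then show ?thesis using i S that by (meson le_less_trans less_trans not_le)
    qed
    then show ?thesis unfolding left_words_def
      by (intro Collect_cong conj_cong refl iffI; elim sorted_wrt_mono_rel[rotated])
        (auto simp: permutations_of_set_def simp del: Diff_iff)
  qed
  moreover have "card ?S + (i - 1) = card A"
    using A finA card_Diff_subset[of "{1..<i}" A] card_mono[of A "{1..<i}"] by simp
  ultimately show ?thesis
    using card_permutations_of_set_decreasing_on_falling_factorial[OF finA, of ?S "i - 1"] A(2) by simp
qed

text \<open>The mirror argument: as \<open>n + 1 - j\<close> is the maximum of \<open>A\<close>, a
  forbidden pair is an ascent with both entries below it, and the \<open>j - 1\<close> values above
  it are free.\<close>

lemma card_right_words_value_sets:
  assumes "r \<le> n" "i \<in> {1..r}" "j \<in> {1..n - r}" and "A \<in> value_sets r n i j"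
  shows "int (card (right_words A ({1..n} - A))) = falling_factorial (int (n - r)) (j - 1)"
proof -
  let ?B = "{1..n} - A" and ?M = "n + 1 - j"
  let ?S = "?B - {?M<..n}"
  from assms have A: "A \<subseteq> {1..n}" "card A = r" "?M \<in> A" "A \<inter> {?M<..n} = {}"
    by (auto simp: value_sets_def)
  have cB: "card ?B = n - r" using A by (simp add: card_Diff_subset finite_subset)
  have S: "x \<in> ?S \<longleftrightarrow> x < ?M" if "x \<in> ?B" for x
    using that A(3) by (cases x ?M rule: linorder_cases) auto
  have "right_words A ?B =
    {xs \<in> permutations_of_set ?B. sorted_wrt (\<lambda>x y. x \<in> ?S \<and> y \<in> ?S \<longrightarrow> y \<le> x) xs}"
  proof -
    have "(\<forall>a\<in>A. \<not> (x < y \<and> y < a)) \<longleftrightarrow> (x \<in> ?S \<and> y \<in> ?S \<longrightarrow> y \<le> x)"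
      if "x \<in> ?B" "y \<in> ?B" for x y
    proof -
      have "a \<in> A \<Longrightarrow> a \<le> ?M" for a using A(1,4) by (meson atLeastAtMost_iff disjoint_iff greaterThanAtMost_iff not_le subsetD)
      then show ?thesis using A(3) S that by (meson less_le_trans less_trans not_le)
    qed
    then show ?thesis unfolding right_words_def
      by (intro Collect_cong conj_cong refl iffI; elim sorted_wrt_mono_rel[rotated])
        (auto simp: permutations_of_set_def simp del: Diff_iff)
  qed
  moreover have "card ?S + (j - 1) = card ?B"
  proof -
    have "{?M<..n} \<subseteq> ?B" using A by auto
    moreover have "card {?M<..n} = j - 1" using assms by auto
    ultimately show ?thesis
      using card_Diff_subset[of "{?M<..n}" ?B] card_mono[of ?B "{?M<..n}"] by simp
  qed
  ultimately show ?thesis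
    using card_permutations_of_set_decreasing_on_falling_factorial[of ?B ?S "j - 1"] cB by auto
qed

text \<open>By cardinality, an \<open>r\<close>-subset other than \<open>{1..r}\<close> neither
  contains nor is contained in \<open>{1..r}\<close>. So it omits a value \<open>\<le> r\<close> and
  contains one above \<open>r\<close>, which puts \<open>i\<close> and \<open>j\<close> in their
  ranges.\<close>

lemma noninitial_subsets_eq_UN_value_sets:
  assumes "r \<le> n"
  shows "{A. A \<subseteq> {1..n} \<and> card A = r} - {{1..r}} =
    (\<Union>(i, j) \<in> {1..r} \<times> {1..n - r}. value_sets r n i j)"
proof (intro equalityI subsetI)
  fix A assume "A \<in> {A. A \<subseteq> {1..n} \<and> card A = r} - {{1..r}}"
  then have A: "A \<subseteq> {1..n}" "card A = r" "A \<noteq> {1..r}" by auto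
  have fin: "finite A" using A(1) by (rule finite_subset) simp
  have not1: "\<not> {1..r} \<subseteq> A" using A fin card_subset_eq[of A "{1..r}"] by auto
  then have ne: "{1..n} - A \<noteq> {}"
    using assms by (metis Diff_eq_empty_iff atLeastatMost_subset_iff order.refl subset_trans)
  have not2: "\<not> A \<subseteq> {1..r}" using A card_subset_eq[of "{1..r}" A] by auto
  then have neA: "A \<noteq> {}" by auto
  define i where "i = Min ({1..n} - A)"
  define M where "M = Max A"
  have i: "i \<in> {1..n} - A" and i_le: "\<And>x. x \<in> {1..n} - A \<Longrightarrow> i \<le> x"
    using Min_in[OF _ ne] by (auto simp: i_def)
  have M: "M \<in> A" and M_ge: "\<And>x. x \<in> A \<Longrightarrow> x \<le> M"
    using Max_in[OF fin neA] fin by (auto simp: M_def)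
  have "i \<le> r" using not1 i_le assms by (meson DiffI atLeastAtMost_iff le_trans subsetI)
  have "r < M" using not2 M_ge A(1) by (meson atLeastAtMost_iff le_trans not_le subsetD subsetI)
  have "M \<le> n" using M A(1) by auto
  have "A \<in> value_sets r n i (n + 1 - M)"
  proof -
    have "{1..<i} \<subseteq> A"
    proof
      fix x assume "x \<in> {1..<i}"
      then have "x \<in> {1..n}" "\<not> i \<le> x" using i by auto
      then show "x \<in> A" using i_le[of x] by blast
    qed
    moreover have "A \<inter> {M<..n} = {}" using M_ge by (metis disjoint_iff greaterThanAtMost_iff not_le)
    moreover have "n + 1 - (n + 1 - M) = M" using \<open>M \<le> n\<close> by simp
    ultimately show ?thesis using A(1,2) i M by (simp add: value_sets_def)
  qed
  moreover have "(i, n + 1 - M) \<in> {1..r} \<times> {1..n - r}"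
    using i \<open>i \<le> r\<close> \<open>r < M\<close> \<open>M \<le> n\<close> by auto
  ultimately show "A \<in> (\<Union>(i, j) \<in> {1..r} \<times> {1..n - r}. value_sets r n i j)" by blast
next
  fix A assume "A \<in> (\<Union>(i, j) \<in> {1..r} \<times> {1..n - r}. value_sets r n i j)"
  \<comment> \<open>A member of a value set omits some \<open>i \<le> r\<close>, so it differs from
    \<open>{1..r}\<close>.\<close>
  then show "A \<in> {A. A \<subseteq> {1..n} \<and> card A = r} - {{1..r}}"
    by (auto simp: value_sets_def)
qed

text \<open>\<open>A\<close> determines both indices: if \<open>i < i'\<close>, then
  \<open>i\<close> would lie in \<open>{1..<i'}\<close> and hence in \<open>A\<close>; two different
  maxima are excluded likewise.\<close>

lemma value_sets_disjoint:
  assumes "r \<le> n" "i \<in> {1..r}" "j \<in> {1..n - r}" "i' \<in> {1..r}" "j' \<in> {1..n - r}"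
    and "A \<in> value_sets r n i j" "A \<in> value_sets r n i' j'"
  shows "i = i' \<and> j = j'"
proof
  have "\<not> i < i'" "\<not> i' < i" using assms by (auto simp: value_sets_def)
  then show "i = i'" by simp
  have "\<not> n + 1 - j < n + 1 - j'" "\<not> n + 1 - j' < n + 1 - j"
    using assms(6,7) by (auto simp: value_sets_def disjoint_iff)
  \<comment> \<open>Both \<open>j\<close> and \<open>j'\<close> are at most \<open>n\<close>, so the
    natural-number subtraction loses nothing.\<close>
  then show "j = j'" using assms by auto
qed

text \<open>Every left value is below every right value, so no forbidden triple can occur and all
  orders are allowed.\<close>

lemma card_words_initial:
  assumes "r \<le> n"
  shows "card (left_words {1..r} ({1..n} - {1..r})) = fact r"
    and "card (right_words {1..r} ({1..n} - {1..r})) = fact (n - r)"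
proof -
  have "sorted_wrt (\<lambda>x y. \<forall>b\<in>{1..n} - {1..r}. \<not> (b < x \<and> x < y)) xs"
    if "xs \<in> permutations_of_set {1..r}" for xs
    using that unfolding sorted_wrt_iff_nth_less
    by (fastforce dest!: permutations_of_setD(1) nth_mem)
  then have "left_words {1..r} ({1..n} - {1..r}) = permutations_of_set {1..r}"
    by (auto simp: left_words_def)
  then show "card (left_words {1..r} ({1..n} - {1..r})) = fact r" by simp
  have "sorted_wrt (\<lambda>x y. \<forall>a\<in>{1..r}. \<not> (x < y \<and> y < a)) ys"
    if "ys \<in> permutations_of_set ({1..n} - {1..r})" for ys
    using that unfolding sorted_wrt_iff_nth_less
    by (fastforce dest!: permutations_of_setD(1) nth_mem)
  then have "right_words {1..r} ({1..n} - {1..r}) = permutations_of_set ({1..n} - {1..r})"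
    by (auto simp: right_words_def)
  then show "card (right_words {1..r} ({1..n} - {1..r})) = fact (n - r)"
    using assms by (simp add: card_Diff_subset)
qed

section \<open>Summing over the sets of left values\<close>

theorem theorem1p2:
  fixes r n :: nat
  assumes "r \<le> n"
  shows "int (k r n) = fact r * fact (n - r) +
    (\<Sum>i=1..r. \<Sum>j=1..n - r.
       int ((n - i - j) choose (r - i)) *
       falling_factorial (int r) (i - 1) * falling_factorial (int (n - r)) (j - 1))"
proof -
  let ?S = "{A. A \<subseteq> {1..n} \<and> card A = r}"
  let ?I = "{1..r} \<times> {1..n - r}"
  let ?V = "\<lambda>(i, j). value_sets r n i j"
  let ?g = "\<lambda>A. int (card (left_words A ({1..n} - A)) * card (right_words A ({1..n} - A)))"
  have finS: "finite ?S" by simp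
  have finV: "finite (value_sets r n i j)" for i j
    by (rule finite_subset[OF _ finS]) (auto simp: value_sets_def)
  have "int (k r n) = sum ?g ?S"
    by (simp add: k_eq_sum_left_right_words[OF assms])
  \<comment> \<open>The initial set \<open>{1..r}\<close> is split off; it yields the term outside
    the double sum.\<close>
  also have "\<dots> = ?g {1..r} + sum ?g (?S - {{1..r}})"
    using assms by (intro sum.remove finS) auto
  also have "?g {1..r} = fact r * fact (n - r)"
    using card_words_initial[OF assms] by simp
  also have "sum ?g (?S - {{1..r}}) = (\<Sum>p\<in>?I. sum ?g (?V p))"
    unfolding noninitial_subsets_eq_UN_value_sets[OF assms]
  proof (rule sum.UNION_disjoint)
    show "\<forall>p\<in>?I. \<forall>q\<in>?I. p \<noteq> q \<longrightarrow> ?V p \<inter> ?V q = {}"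
      using value_sets_disjoint[OF assms] by (fast intro: prod_eqI)
  qed (auto simp: finV)
  also have "\<dots> = (\<Sum>(i, j)\<in>?I. int ((n - i - j) choose (r - i)) *
       falling_factorial (int r) (i - 1) * falling_factorial (int (n - r)) (j - 1))"
  proof (rule sum.cong[OF refl], clarify)
    fix i j assume ij: "i \<in> {1..r}" "j \<in> {1..n - r}"
    \<comment> \<open>On one value set the summand depends only on \<open>i\<close> and
      \<open>j\<close>, so the sum is the size of the set, a binomial coefficient, times a
      constant.\<close>
    have "sum ?g (value_sets r n i j) = (\<Sum>A\<in>value_sets r n i j.
        falling_factorial (int r) (i - 1) * falling_factorial (int (n - r)) (j - 1))"
      using card_left_words_value_sets[OF assms ij] card_right_words_value_sets[OF assms ij]
      by (intro sum.cong) auto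
    then show "sum ?g (value_sets r n i j) = int ((n - i - j) choose (r - i)) *
       falling_factorial (int r) (i - 1) * falling_factorial (int (n - r)) (j - 1)"
      by (simp add: card_value_sets[OF assms ij] mult.assoc)
  qed
  finally show ?thesis by (simp add: sum.cartesian_product)
qed

end
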